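(* Let $p_1=2<p_2=3<p_3<\cdots$ denote the prime numbers in increasing order, let $P_n=\prod_{i=1}^n p_i$, and for real $s>1$ let $$D_n(s)=\sum_{k\ge 1,\ \gcd(k,P_n)=1}\frac{1}{k^s}=\zeta(s)\prod_{j=1}^n\left(1-\frac{1}{p_j^s}\right).$$ Let $s_n$ be the minimal positive real number such that for all $s\ge s_n$ one has $p_{n+1}=\lceil (D_n(s)-1)^{-1/s}\rceil$. Then for all $n\ge 1$, $s_n\le 2p_n$. Consequently, for all $n\ge1$, $$p_{n+1}=\left\lceil\left(-1+\zeta(2p_n)\prod_{j=1}^n\left(1-\frac{1}{p_j^{2p_n}}\right)\right)^{-1/(2p_n)}\right\rceil.$$
   Context: $p_j$ denotes the $j$-th prime; $P_n$ is the product of the first $n$ primes; $\zeta$ is the Riemann zeta function; $\lceil\cdot\rceil$ is the ceiling function.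
   Formalization: The minimal s_n does not exist, because the valid thresholds form an open ray; s_n is read as the infimum of the positive reals σ such that every s ≥ σ satisfies s > 1 and the ceiling formula, and this set is also shown to be non-empty. *)

theory Defs
  imports
    "HOL-Analysis.Analysis"
    "HOL-Computational_Algebra.Primes"
    "HOL-Library.Infinite_Set"
begin

(* Indexed from 1: nth_prime 1 = 2, nth_prime 2 = 3, ...; the value at 0 is never used. *)
definition nth_prime :: "nat \<Rightarrow> nat" where
  "nth_prime j = Infinite_Set.enumerate {p. prime p} (j - 1)"

definition primorial :: "nat \<Rightarrow> nat" where
  "primorial n = (\<Prod>i=1..n. nth_prime i)"

(* The Riemann zeta function on the real half-line s > 1, by its Dirichlet series. *)
definition zeta :: "real \<Rightarrow> real" where
  "zeta s = (\<Sum>\<^sub>\<infinity>k\<in>{1::nat..}. 1 / real k powr s)"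

definition D :: "nat \<Rightarrow> real \<Rightarrow> real" where
  "D n s = (\<Sum>\<^sub>\<infinity>k\<in>{k::nat. k \<ge> 1 \<and> gcd k (primorial n) = 1}. 1 / real k powr s)"

(* The conjunct 1 < s says that D n s is defined. *)
definition thresholds :: "nat \<Rightarrow> real set" where
  "thresholds n = {\<sigma>. 0 < \<sigma> \<and>
     (\<forall>s\<ge>\<sigma>. 1 < s \<and> int (nth_prime (n + 1)) = \<lceil>(D n s - 1) powr (- 1 / s)\<rceil>)}"

(* "Minimal" has to be read as the infimum.  For s > 1 the value (D n s - 1) powr (- 1 / s) is
   continuous in s, always below nth_prime (n + 1), and tends to 0 as s tends to 1 from above.
   Hence the ceiling equation is the open condition that this value exceeds nth_prime (n + 1) - 1,
   so the up-closed set thresholds n is an open ray and has no least element. *)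
definition s_min :: "nat \<Rightarrow> real" where
  "s_min n = Inf (thresholds n)"

end

theory Submission
  imports Defs "HOL-Library.Discrete_Functions"
begin

text \<open>
  Write \<open>p\<close> and \<open>q\<close> for the \<open>n\<close>-th and the next prime. The integers \<open>k > 1\<close> coprime to the
  primorial are odd and at least \<open>q\<close>, and \<open>q\<close> is one of them. Comparing the sum over odd \<open>k \<ge> q\<close>
  with an integral (midpoint rule) gives
  \<open>q powr (- s) \<le> D n s - 1 \<le> (q - 1) powr (1 - s) / (2 * (s - 1))\<close>, and the right-hand side is below
  \<open>(q - 1) powr (- s)\<close> as soon as \<open>q + 1 < 2 * s\<close>. For \<open>s \<ge> 2 * p\<close> this only requires
  \<open>q \<le> 4 * p - 2\<close>, a weak form of Bertrand's postulate, for which Erdos' argument with the central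
  binomial coefficient \<open>4 * p - 2 choose 2 * p - 1\<close> suffices.
\<close>

section \<open>A weak form of Bertrand's postulate\<close>

text \<open>The numbers \<open>1 / ((n + 1) * (n choose k))\<close> form Leibniz' harmonic triangle: each is a difference
  of two of its neighbours, so a common multiple of \<open>1, \<dots>, n + 1\<close> clears all denominators.\<close>

lemma leibniz_triangle_dvd:
  fixes L :: nat
  assumes "\<And>i. 1 \<le> i \<Longrightarrow> i \<le> Suc n \<Longrightarrow> i dvd L" and "k \<le> n"
  shows "Suc n * (n choose k) dvd L"
  using assms
proof (induction k arbitrary: n)
  case 0
  then show ?case by simp
next
  case (Suc k)
  then obtain m where n: "n = Suc m" and km: "k \<le> m"
    by (cases n) auto
  define C where "C = m choose k"
  have C0: "C > 0" using km by (simp add: C_def)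
  have "Suc m * (m choose k) dvd L" using Suc.prems n km by (intro Suc.IH) auto
  then obtain u where u: "L = Suc m * C * u" by (auto simp: C_def dvd_def)
  have "Suc (Suc m) * (Suc m choose k) dvd L" using Suc.prems n km by (intro Suc.IH) auto
  then obtain v where v: "L = Suc (Suc m) * (Suc m choose k) * v" by (auto simp: dvd_def)
  have a: "(Suc m choose Suc k) * Suc k = Suc m * C"
    by (simp only: C_def Suc_times_binomial_eq)
  have b: "(Suc m - k) * (Suc m choose k) = Suc m * C"
    using binomial_absorb_comp[of "Suc m" k] by (simp add: C_def)
  \<comment> \<open>The computation moves to \<open>int\<close> because the quotient sought is the
    difference \<open>u - v\<close>.\<close>
  have bi: "(int m + 1 - int k) * int (Suc m choose k) = (int m + 1) * int C"
  proof -
    have "int (Suc m - k) = int m + 1 - int k" using km by simp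
    then show ?thesis using arg_cong[OF b, of int] by (simp only: of_nat_mult) simp
  qed
  have ai: "int (Suc m choose Suc k) * (int k + 1) = (int m + 1) * int C"
    using arg_cong[OF a, of int] by (simp add: algebra_simps)
  have ui: "int L = (int m + 1) * int C * int u"
    using u by (simp add: algebra_simps)
  have vi: "int L = (int m + 2) * int (Suc m choose k) * int v"
    using v by (simp add: algebra_simps)
  have "(int m + 1 - int k) * int L = (int m + 2) * ((int m + 1) * int C) * int v"
    by (subst bi [symmetric], subst vi) (simp add: algebra_simps)
  then have "(int m + 1) * int C * ((int m + 1 - int k) * int u) =
      (int m + 1) * int C * ((int m + 2) * int v)"
    by (subst (asm) ui) (simp add: algebra_simps)
  then have uv: "(int m + 1 - int k) * int u = (int m + 2) * int v"
    using C0 by (subst (asm) mult_left_cancel) auto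
  \<comment> \<open>Dividing \<open>L\<close> by the harmonic-triangle rule: the quotient for entry
    \<open>Suc k\<close> of row \<open>Suc m\<close> is the quotient \<open>u\<close> for entry
    \<open>k\<close> of row \<open>m\<close> minus the quotient \<open>v\<close> for entry
    \<open>k\<close> of row \<open>Suc m\<close>.\<close>
  have "int L = (int m + 2) * int (Suc m choose Suc k) * (int u - int v)"
  proof -
    have "(int k + 1) * ((int m + 2) * int (Suc m choose Suc k) * (int u - int v)) =
        (int m + 2) * (int (Suc m choose Suc k) * (int k + 1)) * (int u - int v)"
      by (simp only: mult_ac)
    also have "\<dots> = (int m + 1) * int C * ((int m + 2) * int u - (int m + 2) * int v)"
      by (simp only: ai) (simp add: algebra_simps)
    also have "\<dots> = (int m + 1) * int C * ((int m + 2) * int u - (int m + 1 - int k) * int u)"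
      by (simp only: uv)
    also have "\<dots> = (int k + 1) * int L"
      by (simp only: ui) (simp add: algebra_simps)
    finally show ?thesis
      by (metis (no_types, lifting) add.commute mult_left_cancel of_nat_Suc of_nat_eq_0_iff nat.simps(3))
  qed
  then have "int (Suc n * (n choose Suc k)) dvd int L"
    unfolding n by (intro dvdI[where k = "int u - int v"]) (simp add: algebra_simps)
  then show ?case by (simp only: int_dvd_int_iff)
qed

section \<open>Prime powers dividing binomial coefficients\<close>

lemma prime_power_dvd_lcm_nat:
  fixes a b p :: nat
  assumes "prime p" "p ^ e dvd lcm a b"
  shows "p ^ e dvd a \<or> p ^ e dvd b"
proof (cases "a = 0 \<or> b = 0")
  case False
  have u: "\<not> is_unit p" using assms by (auto simp: not_prime_unit)
  have "e \<le> multiplicity p (lcm a b)"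
    using False u assms by (intro multiplicity_geI) (auto simp: lcm_eq_0_iff)
  then show ?thesis
    using False assms by (auto simp: multiplicity_lcm le_max_iff_disj intro: multiplicity_dvd')
qed (use assms in auto)

lemma prime_power_dvd_Lcm_nat:
  fixes p :: nat
  assumes "finite A" "prime p" "p ^ e dvd Lcm A" "e > 0"
  shows "\<exists>a\<in>A. p ^ e dvd a"
  using assms(1,3)
proof (induction A rule: finite_induct)
  case empty
  then show ?case using assms by (auto simp: is_unit_power_iff)
next
  case (insert x A)
  then show ?case
    using prime_power_dvd_lcm_nat[OF \<open>prime p\<close>, of e x "Lcm A"] by auto
qed

text \<open>Takes the place of Legendre's formula. Since
  \<open>k * (n choose k) = n * (n - 1 choose k - 1)\<close>, the harmonic triangle makes the
  binomial coefficient divide \<open>Lcm {1..n}\<close>, and a prime power dividing this lcm divides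
  one of \<open>1, ..., n\<close>.\<close>

lemma prime_power_dvd_binomial_le:
  fixes p n k e :: nat
  assumes "prime p" "p ^ e dvd n choose k" "k \<le> n" "n > 0"
  shows "p ^ e \<le> n"
proof (cases "e = 0 \<or> k = 0")
  case True
  show ?thesis
  proof (cases "e = 0")
    case False
    with True have "p ^ e dvd 1" using assms by simp
    then show ?thesis using False assms by (simp add: is_unit_power_iff)
  qed (use assms in simp)
next
  case False
  obtain m where m: "n = Suc m" using assms by (cases n) auto
  obtain l where l: "k = Suc l" using False by (cases k) auto
  have "Suc m * (m choose l) dvd Lcm {1..n}"
    using assms by (intro leibniz_triangle_dvd) (auto simp: m l)
  then have "n choose k dvd Lcm {1..n}"
    unfolding m l Suc_times_binomial_eq by (metis dvd_mult_left)
  then have "p ^ e dvd Lcm {1..n}" using assms by (metis dvd_trans)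
  then obtain a where "a \<in> {1..n}" "p ^ e dvd a"
    using prime_power_dvd_Lcm_nat[of "{1..n}" p e] False assms by auto
  then show ?thesis by (auto dest!: dvd_imp_le)
qed

section \<open>Erdos' bound for the product of the primes up to n\<close>

lemma prod_primes_dvd_nat:
  fixes n :: nat
  assumes "finite A" "\<And>p. p \<in> A \<Longrightarrow> prime p" "\<And>p. p \<in> A \<Longrightarrow> p dvd n"
  shows "\<Prod>A dvd n"
  using assms
proof (induction A rule: finite_induct)
  case (insert x A)
  have "coprime x (\<Prod>A)"
    using insert by (intro prod_coprime_right) (metis insertCI primes_coprime)
  then show ?case using insert by (simp add: divides_mult)
qed auto

text \<open>Even \<open>n > 2\<close> reduces to \<open>n - 1\<close>. For
  \<open>n = 2 * m + 1\<close>, the primes up to \<open>m + 1\<close> are handled by induction, and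
  those above it all divide \<open>2 * m + 1 choose m\<close>, which is at most
  \<open>4 ^ m\<close>.\<close>

lemma prod_primes_le_four_power: "\<Prod>{p::nat. prime p \<and> p \<le> n} \<le> 4 ^ n"
proof (induction n rule: less_induct)
  case (less n)
  have fin: "finite {p::nat. prime p \<and> p \<le> k}" for k
    by (rule finite_subset[of _ "{..k}"]) auto
  consider "n = 0" | "n = 1" | "n = 2" | "n > 2" "even n" | m where "n = Suc (2 * m)" "m > 0"
    by (metis One_nat_def Suc_lessI gr0I oddE Suc_eq_plus1 mult_0_right less_2_cases not_less_iff_gr_or_eq)
  then show ?case
  proof cases
    case 1
    then have e: "{p::nat. prime p \<and> p \<le> n} = {}" by auto
    show ?thesis unfolding e by simp
  next
    case 2
    then have e: "{p::nat. prime p \<and> p \<le> n} = {}" by (auto dest: prime_ge_2_nat)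
    show ?thesis unfolding e by simp
  next
    case 3
    then have e: "{p::nat. prime p \<and> p \<le> n} = {2}"
      by (auto dest: prime_ge_2_nat intro!: le_antisym)
    show ?thesis unfolding e using 3 by simp
  next
    case 4
    then have "\<not> prime n" using primes_dvd_imp_eq two_is_prime_nat by blast
    then have e: "{p::nat. prime p \<and> p \<le> n} = {p::nat. prime p \<and> p \<le> n - 1}"
      using 4 by (auto simp: le_less)
    have "\<Prod>{p::nat. prime p \<and> p \<le> n - 1} \<le> 4 ^ (n - 1)" using less[of "n - 1"] 4 by simp
    also have "\<dots> \<le> 4 ^ n" by (rule power_increasing) auto
    finally show ?thesis unfolding e .
  next
    case (5 m)
    let ?B = "{p::nat. prime p \<and> Suc m < p \<and> p \<le> n}"
    have e: "{p::nat. prime p \<and> p \<le> n} = {p. prime p \<and> p \<le> Suc m} \<union> ?B" using 5 by auto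
    have finB: "finite ?B" by (rule finite_subset[OF _ fin[of n]]) auto
    have "\<Prod>?B dvd (Suc (2 * m) choose m)"
    proof (rule prod_primes_dvd_nat[OF finB])
      fix p assume p: "p \<in> ?B"
      have "p dvd fact (Suc (2 * m))" using p 5 by (auto simp: prime_dvd_fact_iff simp del: fact_Suc)
      also have "fact (Suc (2 * m)) = fact m * fact (Suc m) * (Suc (2 * m) choose m)"
        using binomial_fact_lemma[of m "Suc (2 * m)"] by (simp add: Suc_diff_le del: fact_Suc)
      finally show "p dvd (Suc (2 * m) choose m)"
        using p by (auto simp: prime_dvd_mult_iff prime_dvd_fact_iff simp del: fact_Suc)
    qed auto
    then have "\<Prod>?B \<le> (Suc (2 * m) choose m)" by (rule dvd_imp_le) simp
    \<comment> \<open>The coefficient occurs twice, at \<open>m\<close> and \<open>m + 1\<close>, in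
      a row with sum \<open>2 * 4 ^ m\<close>.\<close>
    also have "2 * (Suc (2 * m) choose m) \<le> (\<Sum>k\<le>Suc (2 * m). Suc (2 * m) choose k)"
    proof -
      have "2 * (Suc (2 * m) choose m) = (\<Sum>k\<in>{m, Suc m}. Suc (2 * m) choose k)"
        using binomial_symmetric[of m "Suc (2 * m)"] by (simp add: Suc_diff_le)
      also have "\<dots> \<le> (\<Sum>k\<le>Suc (2 * m). Suc (2 * m) choose k)"
        by (rule sum_mono2) auto
      finally show ?thesis .
    qed
    then have "(Suc (2 * m) choose m) \<le> 4 ^ m"
      by (simp only: choose_row_sum) (simp add: power_mult)
    finally have B: "\<Prod>?B \<le> 4 ^ m" .
    have "\<Prod>{p::nat. prime p \<and> p \<le> n} = \<Prod>{p. prime p \<and> p \<le> Suc m} * \<Prod>?B"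
      unfolding e by (rule prod.union_disjoint) (use fin finB in auto)
    also have "\<dots> \<le> 4 ^ Suc m * 4 ^ m"
      using less[of "Suc m"] 5 B by (intro mult_le_mono) auto
    also have "\<dots> = 4 ^ n" using 5 by (simp flip: power_add)
    finally show ?thesis .
  qed
qed

text \<open>Supplies the final growth estimate of the Bertrand argument. The base case
  \<open>21 ^ 4 \<le> 2 ^ 18\<close> would fail one step earlier, as
  \<open>20 ^ 4 > 2 ^ 17\<close>.\<close>

lemma power_four_le_two_power: "(K::nat) \<ge> 21 \<Longrightarrow> K ^ 4 \<le> 2 ^ (K - 3)"
proof (induction K rule: nat_induct_at_least)
  case (Suc K)
  have "(real K + 1) ^ 4 \<le> (real K * (22/21)) ^ 4" using Suc by (intro power_mono) auto
  also have "\<dots> = real K ^ 4 * (22/21) ^ 4" by (simp only: power_mult_distrib)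
  also have "\<dots> \<le> real K ^ 4 * 2" by (intro mult_left_mono) (auto simp: power4_eq_xxxx)
  finally have "real (Suc K ^ 4) \<le> real (2 * K ^ 4)" by (simp add: add_ac)
  then have "Suc K ^ 4 \<le> 2 * K ^ 4" by (simp only: of_nat_le_iff)
  also have "\<dots> \<le> 2 * 2 ^ (K - 3)" using Suc by simp
  also have "\<dots> = 2 ^ (Suc K - 3)" using Suc by (simp flip: power_Suc add: Suc_diff_le)
  finally show ?case .
qed auto

text \<open>Each prime contributes at most \<open>2 * m\<close> to the coefficient, and primes above
  the square root of \<open>2 * m\<close> occur at most once. What remains is a product of distinct
  primes up to \<open>x\<close>, bounded by \<open>4 ^ x\<close>.\<close>

lemma central_binomial_le_of_no_primes:
  fixes m x :: nat
  assumes "m > 0" and no: "\<And>p. prime p \<Longrightarrow> p \<le> 2 * m \<Longrightarrow> p \<le> x"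
  shows "(2 * m choose m) \<le> (2 * m) ^ floor_sqrt (2 * m) * 4 ^ x"
proof -
  define N where "N = 2 * m"
  define k where "k = floor_sqrt N"
  define C where "C = N choose m"
  have N0: "N > 0" "m \<le> N" using assms by (auto simp: N_def)
  have C0: "C > 0" using N0 by (simp add: C_def)
  have le: "r ^ multiplicity r C \<le> N" if "prime r" for r
    using prime_power_dvd_binomial_le[OF that, of "multiplicity r C" N m] N0
    by (simp add: C_def multiplicity_dvd)
  \<comment> \<open>The surplus factor \<open>r\<close> for small primes is harmless and lets the
    product split uniformly into a power of \<open>N\<close> and \<open>\<Prod>?P\<close>.\<close>
  have fac: "r ^ multiplicity r C \<le> (if r \<le> k then N else 1) * r" if r: "prime r" for r
  proof (cases "r \<le> k")
    case True
    have "r ^ multiplicity r C \<le> N" by (rule le[OF r])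
    also have "N \<le> N * r" using prime_gt_0_nat[OF r] by simp
    finally show ?thesis using True by simp
  next
    case False
    have "multiplicity r C < 2"
    proof (rule ccontr)
      assume "\<not> multiplicity r C < 2"
      then have "r ^ 2 \<le> r ^ multiplicity r C"
        using prime_gt_0_nat[OF r] by (intro power_increasing) auto
      with le[OF r] have "r ^ 2 \<le> N" by simp
      then have "r \<le> k" unfolding k_def by (simp add: le_floor_sqrt_iff)
      with False show False by simp
    qed
    then have "r ^ multiplicity r C \<le> r ^ 1"
      using prime_gt_0_nat[OF r] by (intro power_increasing) auto
    then show ?thesis using False by simp
  qed
  let ?P = "prime_factors C"
  have sub: "?P \<subseteq> {p. prime p \<and> p \<le> x}"
  proof
    fix p assume p: "p \<in> ?P"
    then have "p \<le> p ^ multiplicity p C"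
      by (intro self_le_power)
        (auto simp: prime_factors_multiplicity intro: Suc_leI prime_gt_0_nat)
    then have "p \<le> N" using le[of p] p by (meson in_prime_factors_imp_prime order_trans)
    then show "p \<in> {p. prime p \<and> p \<le> x}" using no[of p] p by (auto simp: N_def)
  qed
  have fin: "finite {p::nat. prime p \<and> p \<le> x}"
    by (rule finite_subset[of _ "{..x}"]) auto
  have "C = (\<Prod>p\<in>?P. p ^ multiplicity p C)" using C0 by (rule prime_factorization_nat)
  also have "\<dots> \<le> (\<Prod>p\<in>?P. (if p \<le> k then N else 1) * p)"
    by (intro prod_mono conjI fac) auto
  also have "\<dots> = (\<Prod>p\<in>?P. if p \<le> k then N else 1) * \<Prod>?P" by (simp add: prod.distrib)
  also have "(\<Prod>p\<in>?P. if p \<le> k then N else 1) = N ^ card {p \<in> ?P. p \<le> k}"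
    by (simp add: prod.If_cases Int_def)
  also have "\<dots> * \<Prod>?P \<le> N ^ k * 4 ^ x"
  proof (intro mult_le_mono power_increasing)
    have "{p \<in> ?P. p \<le> k} \<subseteq> {1..k}"
      by (auto intro!: Suc_leI prime_gt_0_nat dest: in_prime_factors_imp_prime)
    then have "card {p \<in> ?P. p \<le> k} \<le> card {1..k}" by (intro card_mono) auto
    then show "card {p \<in> ?P. p \<le> k} \<le> k" by simp
    have "\<Prod>?P \<le> \<Prod>{p. prime p \<and> p \<le> x}"
      using fin sub by (intro dvd_imp_le prod_dvd_prod_subset) (auto intro!: prod_pos prime_gt_0_nat)
    also have "\<dots> \<le> 4 ^ x" by (rule prod_primes_le_four_power)
    finally show "\<Prod>?P \<le> 4 ^ x" .
  qed (use N0 in auto)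
  finally show ?thesis by (simp add: C_def N_def k_def)
qed

lemma ex_prime_between_four_times:
  fixes x :: nat
  assumes "x \<ge> 2"
  shows "\<exists>q. prime q \<and> x < q \<and> q \<le> 4 * x - 2"
proof (cases "x \<le> 240")
  case True
  \<comment> \<open>Each prime of the chain is at most \<open>4 * x - 2\<close> for \<open>x\<close>
    equal to its predecessor, starting from \<open>x = 2\<close>; 241 covers \<open>x\<close> up to
    240.\<close>
  have pr: "prime (5::nat)" "prime (17::nat)" "prime (61::nat)" "prime (241::nat)" by simp_all
  consider "x < 5" | "5 \<le> x" "x < 17" | "17 \<le> x" "x < 61" | "61 \<le> x" by linarith
  then show ?thesis
  proof cases
    case 1 then show ?thesis using pr assms by (intro exI[of _ 5]) auto
  next
    case 2 then show ?thesis using pr by (intro exI[of _ 17]) auto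
  next
    case 3 then show ?thesis using pr by (intro exI[of _ 61]) auto
  next
    case 4 then show ?thesis using pr True by (intro exI[of _ 241]) auto
  qed
next
  case False
  show ?thesis
  proof (rule ccontr)
    assume no: "\<not> ?thesis"
    \<comment> \<open>With this \<open>m\<close>, \<open>2 * m\<close> is the right end of the
      interval, and \<open>4 ^ m\<close> exceeds \<open>4 ^ x\<close> by the factor
      \<open>4 ^ (x - 1)\<close>. The successor in \<open>K\<close> absorbs the factor
      \<open>N\<close> lost in the lower bound for the central coefficient.\<close>
    define m where "m = 2 * x - 1"
    define N where "N = 2 * m"
    define K where "K = Suc (floor_sqrt N)"
    have m0: "m > 0" and N: "N = 4 * x - 2" using False by (auto simp: m_def N_def)
    have "p \<le> x" if "prime p" "p \<le> 2 * m" for p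
      using no that by (metis N N_def not_le)
    then have C: "(N choose m) \<le> N ^ floor_sqrt N * 4 ^ x"
      unfolding N_def by (intro central_binomial_le_of_no_primes m0)
    have K21: "K \<ge> 21"
    proof -
      have "20\<^sup>2 \<le> N" using False by (simp add: N)
      then have "20 \<le> floor_sqrt N" by (simp only: le_floor_sqrt_iff)
      then show ?thesis by (simp add: K_def)
    qed
    have NK: "N \<le> K ^ 2"
      unfolding K_def by (rule less_imp_le[OF Suc_floor_sqrt_power2_gt])
    have KN: "(K - 1)\<^sup>2 \<le> N"
      unfolding K_def by simp
    have "4 ^ m \<le> N * (N choose m)"
    proof -
      have "4 ^ m / real N \<le> real (N choose m)"
        using central_binomial_lower_bound[OF m0] by (simp add: N_def)
      then have "real (4 ^ m) \<le> real (N * (N choose m))"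
        using m0 by (simp add: N_def field_simps)
      then show ?thesis by (simp only: of_nat_le_iff)
    qed
    also have "\<dots> \<le> N * (N ^ floor_sqrt N * 4 ^ x)" using C by (rule mult_le_mono2)
    also have "\<dots> = N ^ K * 4 ^ x" by (simp add: K_def)
    also have "4 ^ m = (4::nat) ^ (x - 1) * 4 ^ x"
      using False by (simp flip: power_add add: m_def)
    finally have "4 ^ (x - 1) \<le> N ^ K" by simp
    also have "\<dots> \<le> (K ^ 2) ^ K" using NK by (rule power_mono) simp
    \<comment> \<open>Squaring produces \<open>K ^ 4\<close>, which can then be replaced by
      \<open>2 ^ (K - 3)\<close>.\<close>
    finally have "(4 ^ (x - 1)) ^ 2 \<le> ((K ^ 2) ^ K) ^ 2" by (rule power_mono) simp
    also have "((K ^ 2) ^ K) ^ 2 = (K ^ 4) ^ K" by (simp flip: power_mult)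
    also have "\<dots> \<le> (2 ^ (K - 3)) ^ K"
      by (intro power_mono power_four_le_two_power K21) simp
    also have "((4::nat) ^ (x - 1)) ^ 2 = 2 ^ (4 * x - 4)"
    proof -
      have "4 * x - 4 = 2 * (x - 1) * 2" using False by simp
      then show ?thesis by (simp only: power_mult) simp
    qed
    also have "((2::nat) ^ (K - 3)) ^ K = 2 ^ ((K - 3) * K)" by (simp only: power_mult)
    finally have "4 * x - 4 \<le> (K - 3) * K" by simp
    \<comment> \<open>The contradiction is
      \<open>K * (K - 3) < (K - 1) ^ 2 - 2 \<le> 4 * x - 4\<close>; the substitution removes
      truncated subtraction.\<close>
    moreover obtain j where "K = j + 3" using K21 by (intro that[of "K - 3"]) simp
    ultimately show False
      using KN False K21 by (simp add: N power2_eq_square algebra_simps)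
  qed
qed

section \<open>The Dirichlet series over integers coprime to a primorial\<close>

text \<open>This is the midpoint rule for the convex function \<open>x powr (- s)\<close> on \<open>[k - 1, k + 1]\<close>.\<close>

lemma powr_le_central_difference:
  fixes k s :: real
  assumes "s > 1" "k > 1"
  shows "2 * (s - 1) * k powr (- s) \<le> (k - 1) powr (1 - s) - (k + 1) powr (1 - s)"
proof -
  \<comment> \<open>The half-width \<open>t\<close> of the interval becomes a variable:
    \<open>f 0 = 0\<close>, and \<open>f 1 \<ge> 0\<close> is the claim.\<close>
  define f where "f t = (k - t) powr (1 - s) - (k + t) powr (1 - s) - 2 * (s - 1) * t * k powr (- s)" for t
  have "f 0 \<le> f 1"
  proof (rule DERIV_nonneg_imp_nondecreasing[of 0 1 f])
    fix t :: real assume t: "0 \<le> t" "t \<le> 1"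
    \<comment> \<open>Half exponents make \<open>2 * ?a * ?b \<le> ?a ^ 2 + ?b ^ 2\<close> the
      convexity inequality needed for the derivative of \<open>f\<close>.\<close>
    let ?a = "(k - t) powr (- s / 2)" and ?b = "(k + t) powr (- s / 2)"
    have "k powr (- s) = (k * k) powr (- s / 2)"
      using assms by (simp add: powr_mult flip: powr_add)
    also have "\<dots> \<le> ((k - t) * (k + t)) powr (- s / 2)"
    proof -
      have "(k - t) * (k + t) > 0" using assms t by (intro mult_pos_pos) auto
      moreover have "(k - t) * (k + t) \<le> k * k" by (simp add: algebra_simps)
      ultimately show ?thesis using assms by (intro powr_mono2') auto
    qed
    also have "\<dots> = ?a * ?b" using assms t by (simp add: powr_mult)
    finally have "2 * k powr (- s) \<le> 2 * ?a * ?b" by simp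
    also have "\<dots> \<le> ?a\<^sup>2 + ?b\<^sup>2" by (rule sum_squares_bound)
    also have "\<dots> = (k - t) powr (- s) + (k + t) powr (- s)"
      by (simp add: power2_eq_square flip: powr_add)
    finally have "0 \<le> (s - 1) * ((k - t) powr (- s) + (k + t) powr (- s) - 2 * k powr (- s))"
      using assms by simp
    moreover have "(f has_real_derivative
        (s - 1) * ((k - t) powr (- s) + (k + t) powr (- s) - 2 * k powr (- s))) (at t)"
      unfolding f_def using assms t
      by (auto intro!: derivative_eq_intros simp: algebra_simps)
    ultimately show "\<exists>y. (f has_real_derivative y) (at t) \<and> 0 \<le> y" by blast
  qed simp
  then show ?thesis by (simp add: f_def)
qed

text \<open>The midpoint intervals around \<open>q + 2 * i\<close> abut, so the central differences
  telescope.\<close>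

lemma sum_odd_powr_le:
  fixes q :: nat and s :: real
  assumes "s > 1" "q > 1"
  shows "(\<Sum>i<N. 1 / real (q + 2 * i) powr s) \<le> (real q - 1) powr (1 - s) / (2 * (s - 1))"
proof -
  let ?g = "\<lambda>i::nat. (real q - 1 + 2 * real i) powr (1 - s)"
  have "2 * (s - 1) * (\<Sum>i<N. 1 / real (q + 2 * i) powr s) \<le> (\<Sum>i<N. ?g i - ?g (Suc i))"
    unfolding sum_distrib_left
  proof (rule sum_mono)
    fix i
    show "2 * (s - 1) * (1 / real (q + 2 * i) powr s) \<le> ?g i - ?g (Suc i)"
      using powr_le_central_difference[of s "real (q + 2 * i)"] assms
      by (simp add: powr_minus_divide algebra_simps)
  qed
  also have "\<dots> = ?g 0 - ?g N" by (rule sum_lessThan_telescope')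
  also have "\<dots> \<le> (real q - 1) powr (1 - s)" by simp
  finally show ?thesis using assms by (simp add: field_simps)
qed

lemma summable_on_inverse_powr:
  fixes s :: real and A :: "nat set"
  assumes "s > 1"
  shows "(\<lambda>k. 1 / real k powr s) summable_on A"
proof -
  have "summable (\<lambda>k. real k powr (- s))" using assms by (simp add: summable_real_powr_iff)
  then have "(\<lambda>k. 1 / real k powr s) summable_on UNIV"
    by (subst summable_on_UNIV_nonneg_real_iff) (auto simp: powr_minus_divide)
  then show ?thesis by (rule summable_on_subset) simp
qed

section \<open>Enumerated primes and coprimality to primorials\<close>

lemma prime_nth_prime: "prime (nth_prime j)"
  using enumerate_in_set[OF primes_infinite] by (simp add: nth_prime_def)

text \<open>The bound \<open>1 \<le> i\<close> matters: by truncated subtraction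
  \<open>nth_prime 0 = nth_prime 1\<close>.\<close>

lemma nth_prime_strict_mono: "1 \<le> i \<Longrightarrow> i < j \<Longrightarrow> nth_prime i < nth_prime j"
  using primes_infinite by (simp add: nth_prime_def)

lemma nth_prime_1: "nth_prime 1 = 2"
  by (auto simp: nth_prime_def enumerate_0 intro!: Least_equality dest: prime_ge_2_nat)

lemma ex_nth_prime_eq:
  assumes "prime p"
  shows "\<exists>i\<ge>1. nth_prime i = p"
proof -
  obtain i where "enumerate {p. prime p} i = p"
    using enumerate_Ex[of "{p::nat. prime p}" p] primes_infinite assms by auto
  then show ?thesis by (intro exI[of _ "Suc i"]) (simp add: nth_prime_def)
qed

lemma nth_prime_Suc_le:
  assumes "n \<ge> 1" "prime p" "nth_prime n < p"
  shows "nth_prime (n + 1) \<le> p"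
proof -
  obtain i where i: "i \<ge> 1" "nth_prime i = p" using ex_nth_prime_eq assms by blast
  have "n < i" using assms i nth_prime_strict_mono[of i n] by (cases "i < n"; cases "i = n") auto
  then show ?thesis using nth_prime_strict_mono[of "n + 1" i] i by (cases "n + 1 = i") auto
qed

lemma coprime_primorial_iff:
  "coprime k (primorial n) \<longleftrightarrow> (\<forall>i. 1 \<le> i \<longrightarrow> i \<le> n \<longrightarrow> \<not> nth_prime i dvd k)"
proof
  assume "coprime k (primorial n)"
  moreover have "nth_prime i dvd primorial n" if "1 \<le> i" "i \<le> n" for i
    unfolding primorial_def using that by (intro dvd_prodI) auto
  ultimately show "\<forall>i. 1 \<le> i \<longrightarrow> i \<le> n \<longrightarrow> \<not> nth_prime i dvd k"
    using prime_nth_prime not_prime_unit coprime_common_divisor by metis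
next
  assume "\<forall>i. 1 \<le> i \<longrightarrow> i \<le> n \<longrightarrow> \<not> nth_prime i dvd k"
  then show "coprime k (primorial n)"
    unfolding primorial_def
    by (intro prod_coprime_right) (auto simp: coprime_commute[of k] intro!: prime_imp_coprime prime_nth_prime)
qed

lemma coprime_primorial_ge:
  assumes "coprime k (primorial n)" "k > 1"
  shows "nth_prime (n + 1) \<le> k"
proof -
  obtain p where p: "prime p" "p dvd k" using prime_factor_nat[of k] assms by auto
  obtain i where i: "i \<ge> 1" "nth_prime i = p" using ex_nth_prime_eq p by blast
  have "\<not> i \<le> n"
    using assms i p by (auto simp: coprime_primorial_iff)
  then have "nth_prime (n + 1) \<le> p"
    using nth_prime_strict_mono[of "n + 1" i] i by (cases "n + 1 = i") auto
  also have "p \<le> k" using p assms by (intro dvd_imp_le) auto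
  finally show ?thesis .
qed

lemma coprime_nth_prime_primorial: "coprime (nth_prime (Suc n)) (primorial n)"
  unfolding coprime_primorial_iff
  by (metis nth_prime_strict_mono prime_nth_prime primes_dvd_imp_eq less_Suc_eq_le less_irrefl)

section \<open>The Euler product and two-sided bounds for D\<close>

lemma D_altdef: "D n s = (\<Sum>\<^sub>\<infinity>k\<in>{k. k \<ge> 1 \<and> coprime k (primorial n)}. 1 / real k powr s)"
  unfolding D_def coprime_iff_gcd_eq_1 ..

lemma D_0: "D 0 s = zeta s"
  by (simp add: D_altdef zeta_def primorial_def atLeast_def)

text \<open>One sieve step: the multiples of the new prime \<open>p\<close> in the index set
  \<open>A n\<close> are exactly \<open>p\<close> times \<open>A n\<close>, so removing them
  subtracts \<open>p powr (- s)\<close> times the whole sum.\<close>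

lemma D_Suc:
  assumes "s > 1"
  shows "D (Suc n) s = D n s * (1 - 1 / real (nth_prime (Suc n)) powr s)"
proof -
  define A where "A n = {k::nat. k \<ge> 1 \<and> coprime k (primorial n)}" for n
  define p where "p = nth_prime (Suc n)"
  let ?f = "\<lambda>k::nat. 1 / real k powr s"
  have p: "prime p" by (simp add: p_def prime_nth_prime)
  have Suc_iff: "k \<in> A (Suc n) \<longleftrightarrow> k \<in> A n \<and> \<not> p dvd k" for k
    using p by (auto simp: A_def coprime_primorial_iff p_def le_Suc_eq)
  have mult_iff: "p * j \<in> A n \<longleftrightarrow> j \<in> A n" for j
    using coprime_nth_prime_primorial[of n] p
    by (auto simp: A_def p_def prime_gt_0_nat Suc_le_eq)
  have split: "A n = A (Suc n) \<union> (*) p ` A n"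
  proof (intro equalityI subsetI)
    fix k assume k: "k \<in> A n"
    show "k \<in> A (Suc n) \<union> (*) p ` A n"
    proof (cases "p dvd k")
      case True
      then obtain j where "k = p * j" by (elim dvdE)
      with k show ?thesis by (auto simp: mult_iff)
    qed (use k Suc_iff in auto)
  qed (auto simp: Suc_iff mult_iff)
  have disj: "A (Suc n) \<inter> (*) p ` A n = {}"
    by (auto simp: Suc_iff)
  have "infsum ?f (A n) = infsum ?f (A (Suc n) \<union> (*) p ` A n)" by (simp flip: split)
  also have "\<dots> = infsum ?f (A (Suc n)) + infsum ?f ((*) p ` A n)"
    by (intro infsum_Un_disjoint summable_on_inverse_powr assms disj)
  also have "infsum ?f ((*) p ` A n) = infsum (?f \<circ> (*) p) (A n)"
    using p by (intro infsum_reindex) (auto intro!: inj_onI)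
  also have "?f \<circ> (*) p = (\<lambda>k. ?f p * ?f k)"
    by (auto simp: powr_mult)
  also have "infsum \<dots> (A n) = ?f p * infsum ?f (A n)"
    by (rule infsum_cmult_right')
  finally show ?thesis
    by (simp add: D_altdef A_def p_def algebra_simps)
qed

lemma D_eq_zeta_prod:
  assumes "s > 1"
  shows "D n s = zeta s * (\<Prod>j=1..n. 1 - 1 / real (nth_prime j) powr s)"
  by (induction n) (simp_all add: D_0 D_Suc assms)

lemma D_minus_1:
  assumes "s > 1"
  shows "D n s - 1 = (\<Sum>\<^sub>\<infinity>k\<in>{k::nat. k > 1 \<and> coprime k (primorial n)}. 1 / real k powr s)"
proof -
  have "{k::nat. k \<ge> 1 \<and> coprime k (primorial n)} = {1} \<union> {k. k > 1 \<and> coprime k (primorial n)}"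
    by auto
  then show ?thesis unfolding D_altdef
    by (simp only:) (subst infsum_Un_disjoint, auto intro: summable_on_inverse_powr assms)
qed

lemma D_minus_1_ge:
  assumes "s > 1"
  shows "1 / real (nth_prime (n + 1)) powr s \<le> D n s - 1"
proof -
  have "(\<Sum>k\<in>{nth_prime (n + 1)}. 1 / real k powr s) \<le> D n s - 1"
    unfolding D_minus_1[OF assms]
    using coprime_nth_prime_primorial[of n] prime_gt_1_nat[OF prime_nth_prime[of "n + 1"]]
    by (intro finite_sum_le_infsum summable_on_inverse_powr assms) auto
  then show ?thesis by simp
qed

text \<open>As \<open>n \<ge> 1\<close>, the prime 2 is sieved out, so every index is odd, at least
  the odd prime \<open>q\<close>, and hence of the form \<open>q + 2 * i\<close>. It suffices to
  bound finite partial sums.\<close>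

lemma D_minus_1_le:
  assumes "s > 1" "n \<ge> 1"
  shows "D n s - 1 \<le> (real (nth_prime (n + 1)) - 1) powr (1 - s) / (2 * (s - 1))"
  unfolding D_minus_1[OF assms(1)]
proof (rule infsum_le_finite_sums[OF summable_on_inverse_powr[OF assms(1)]])
  define q where "q = nth_prime (n + 1)"
  have odd: "odd k" if "coprime k (primorial n)" for k
    using that assms nth_prime_1 by (auto simp: coprime_primorial_iff)
  have q: "odd q" "q > 1"
    using odd[OF coprime_nth_prime_primorial[of n]] prime_gt_1_nat[OF prime_nth_prime[of "n + 1"]]
    by (simp_all add: q_def)
  fix F assume F: "finite F" "F \<subseteq> {k. k > 1 \<and> coprime k (primorial n)}"
  let ?h = "\<lambda>i. q + 2 * i"
  \<comment> \<open>\<open>Max F\<close> is a crude bound for the index \<open>i\<close>; for empty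
    \<open>F\<close> its value is irrelevant.\<close>
  have sub: "F \<subseteq> ?h ` {..<Suc (Max F)}"
  proof
    fix k assume k: "k \<in> F"
    then have "odd k" "q \<le> k" using F odd coprime_primorial_ge[of k n] by (auto simp: q_def)
    then have "even (k - q)" using q by simp
    then obtain i where i: "k - q = 2 * i" by (elim evenE)
    moreover have "k \<le> Max F" using F k by simp
    ultimately show "k \<in> ?h ` {..<Suc (Max F)}"
      using \<open>q \<le> k\<close> by (intro image_eqI[of _ _ i]) auto
  qed
  have "(\<Sum>k\<in>F. 1 / real k powr s) \<le> (\<Sum>k\<in>?h ` {..<Suc (Max F)}. 1 / real k powr s)"
    by (rule sum_mono2[OF _ sub]) auto
  also have "\<dots> = (\<Sum>i<Suc (Max F). 1 / real (q + 2 * i) powr s)"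
    by (subst sum.reindex) (auto intro!: inj_onI)
  also have "\<dots> \<le> (real q - 1) powr (1 - s) / (2 * (s - 1))"
    using assms q by (intro sum_odd_powr_le) auto
  finally show "(\<Sum>k\<in>F. 1 / real k powr s) \<le>
      (real (nth_prime (n + 1)) - 1) powr (1 - s) / (2 * (s - 1))" by (simp add: q_def)
qed

section \<open>From the bounds to the ceiling formula\<close>

lemma ceiling_D_eq_nth_prime:
  assumes "n \<ge> 1" "s > 1" "real (nth_prime (n + 1)) + 1 < 2 * s"
  shows "\<lceil>(D n s - 1) powr (- 1 / s)\<rceil> = int (nth_prime (n + 1))"
proof -
  define q where "q = real (nth_prime (n + 1))"
  have q: "q > 1" using prime_gt_1_nat[OF prime_nth_prime[of "n + 1"]] by (simp add: q_def)
  have root: "(x powr (- s)) powr (- 1 / s) = x" if "x > 0" for x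
    using that assms by (simp add: powr_powr)
  have lo: "q powr (- s) \<le> D n s - 1"
    using D_minus_1_ge[of s n] assms by (simp add: q_def powr_minus_divide)
  have pos: "D n s - 1 > 0" using lo q by (smt (verit) powr_gt_zero)
  have "D n s - 1 \<le> (q - 1) powr (1 - s) / (2 * (s - 1))"
    using D_minus_1_le assms by (simp add: q_def)
  also have "\<dots> = (q - 1) powr (- s) * ((q - 1) / (2 * (s - 1)))"
    using powr_add[of "q - 1" "- s" 1] q by simp
  also have "\<dots> < (q - 1) powr (- s)"
  proof -
    have "(q - 1) / (2 * (s - 1)) < 1" using assms by (simp add: q_def)
    moreover have "(q - 1) powr (- s) > 0" using q by simp
    ultimately show ?thesis by (metis mult.right_neutral mult_less_cancel_left_pos)
  qed
  finally have hi: "D n s - 1 < (q - 1) powr (- s)" .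
  \<comment> \<open>The exponent \<open>- 1 / s\<close> is negative, so both bounds reverse. Only
    the bound by \<open>q - 1\<close> has to be strict for the ceiling.\<close>
  have "(D n s - 1) powr (- 1 / s) \<le> (q powr (- s)) powr (- 1 / s)"
    using lo pos q assms by (intro powr_mono2') auto
  moreover have "((q - 1) powr (- s)) powr (- 1 / s) < (D n s - 1) powr (- 1 / s)"
    using hi pos assms by (intro powr_less_mono2_neg) auto
  ultimately have "q - 1 < (D n s - 1) powr (- 1 / s)" "(D n s - 1) powr (- 1 / s) \<le> q"
    using q by (simp_all only: root)
  then show ?thesis by (intro ceiling_unique) (simp_all add: q_def)
qed

theorem mainTheorem3:
  fixes n :: nat
  assumes "n \<ge> 1"
  shows "(\<forall>s>1. D n s = zeta s * (\<Prod>j=1..n. 1 - 1 / real (nth_prime j) powr s))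
    \<and> thresholds n \<noteq> {} \<and> s_min n \<le> 2 * real (nth_prime n)
    \<and> int (nth_prime (n + 1)) =
        \<lceil>(- 1 + zeta (2 * real (nth_prime n)) *
            (\<Prod>j=1..n. 1 - 1 / real (nth_prime j) powr (2 * real (nth_prime n))))
          powr (- 1 / (2 * real (nth_prime n)))\<rceil>"
proof -
  define \<sigma> where "\<sigma> = 2 * real (nth_prime n)"
  have p2: "nth_prime n \<ge> 2" using prime_ge_2_nat[OF prime_nth_prime] .
  then have \<sigma>: "\<sigma> > 1" by (simp add: \<sigma>_def)
  obtain r where r: "prime r" "nth_prime n < r" "r \<le> 4 * nth_prime n - 2"
    using ex_prime_between_four_times[OF p2] by blast
  then have "nth_prime (n + 1) \<le> 4 * nth_prime n - 2"
    using nth_prime_Suc_le[OF assms] by (meson order_trans)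
  \<comment> \<open>The next prime plus one is at most \<open>4 * nth_prime n - 1\<close>, just
    below \<open>2 * \<sigma>\<close>; the condition persists for larger \<open>s\<close>.\<close>
  then have q: "real (nth_prime (n + 1)) + 1 < 2 * \<sigma>" using p2 by (simp add: \<sigma>_def)
  have ceil: "int (nth_prime (n + 1)) = \<lceil>(D n s - 1) powr (- 1 / s)\<rceil>" if "s \<ge> \<sigma>" for s
    using ceiling_D_eq_nth_prime[OF assms, of s] that \<sigma> q by simp
  have mem: "\<sigma> \<in> thresholds n"
    using \<sigma> ceil by (auto simp: thresholds_def)
  have "bdd_below (thresholds n)"
    by (rule bdd_belowI[of _ 0]) (auto simp: thresholds_def)
  with mem have "s_min n \<le> \<sigma>" unfolding s_min_def by (rule cInf_lower)
  moreover have "int (nth_prime (n + 1)) =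
      \<lceil>(- 1 + zeta \<sigma> * (\<Prod>j=1..n. 1 - 1 / real (nth_prime j) powr \<sigma>)) powr (- 1 / \<sigma>)\<rceil>"
    using ceil[of \<sigma>] D_eq_zeta_prod[OF \<sigma>, of n] by simp
  ultimately show ?thesis
    using mem D_eq_zeta_prod unfolding \<sigma>_def by blast
qed

end
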